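(* One has the following recursion formula for the functions $F_r(x,y)$: $$(i)\quad F_0(x,y)=\frac1{(1-y)^2},$$ $$(ii)\quad F_r(x,y)=\frac{F_{r-1}(x,x^r)\,x^r-F_{r-1}(x,y)\,y}{(x^r-y)(1-y)}\qquad (r\ge1).$$
   Context: For integers $r,k,j\ge 0$ let $$\alpha_r(k,j)=\sum_{\substack{c_1+\cdots+c_r=k\\ 0\le c_1\le\cdots\le c_r}}\ \sum_{d_0=-j}^{0}\ \sum_{d_1=d_0}^{c_1}\ \sum_{d_2=d_1}^{c_2}\cdots\sum_{d_r=d_{r-1}}^{c_r}1,$$ with all $c_i,d_i$ integers (for $r=0$ the outer sum is empty unless $k=0$, in which case only the sum over $d_0$ remains). The generating function is $F_r(x,y)=\sum_{k,j=0}^\infty\alpha_r(k,j)x^ky^j$. The identities are understood as identities of formal power series in $x,y$ (in (ii), after multiplying by the denominator). *)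

theory Defs
  imports "HOL-Computational_Algebra.Formal_Power_Series"
begin

text \<open>
  \<open>nested d [c\<^sub>1, \<dots>, c\<^sub>r]\<close> is the iterated sum over \<open>d\<^sub>1 = d..c\<^sub>1\<close>,
  \<open>d\<^sub>2 = d\<^sub>1..c\<^sub>2\<close>, \<dots>, \<open>d\<^sub>r = d\<^bsub>r-1\<^esub>..c\<^sub>r\<close> of the constant \<open>1\<close>.
\<close>

fun nested :: "int \<Rightarrow> int list \<Rightarrow> nat" where
  "nested d [] = 1"
| "nested d (c # cs) = (\<Sum>d'=d..c. nested d' cs)"

definition parts :: "nat \<Rightarrow> nat \<Rightarrow> int list set" where
  "parts r k = {cs. length cs = r \<and> sorted cs \<and> (\<forall>c\<in>set cs. 0 \<le> c) \<and> sum_list cs = int k}"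

lemma finite_parts: "finite (parts r k)"
proof (rule finite_subset)
  show "parts r k \<subseteq> {cs. set cs \<subseteq> {0..int k} \<and> length cs = r}"
  proof
    fix cs assume "cs \<in> parts r k"
    then have "length cs = r" "\<forall>c\<in>set cs. 0 \<le> c" "sum_list cs = int k"
      by (auto simp: parts_def)
    moreover have "c \<le> sum_list cs" if "c \<in> set cs" "\<forall>c\<in>set cs. 0 \<le> c" for c and cs :: "int list"
      using that by (induction cs) (auto simp: sum_list_nonneg add_increasing)
    ultimately show "cs \<in> {cs. set cs \<subseteq> {0..int k} \<and> length cs = r}"
      by fastforce
  qed
  show "finite {cs. set cs \<subseteq> {0..int k} \<and> length cs = r}"
    by (rule finite_lists_length_eq) simp
qed

definition alpha :: "nat \<Rightarrow> nat \<Rightarrow> nat \<Rightarrow> nat" where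
  "alpha r k j = (\<Sum>cs\<in>parts r k. \<Sum>d = - int j..0. nested d cs)"

text \<open>
  Series in \<open>x, y\<close> are represented as power series in \<open>y\<close> whose coefficients are power series
  in \<open>x\<close>. The coefficient field is that of the rationals, so that division is available.
\<close>

abbreviation var_x :: "rat fps fps" where "var_x \<equiv> fps_const fps_X"
abbreviation var_y :: "rat fps fps" where "var_y \<equiv> fps_X"

definition genfun :: "nat \<Rightarrow> rat fps fps" where
  "genfun r = Abs_fps (\<lambda>j. Abs_fps (\<lambda>k. of_nat (alpha r k j)))"

text \<open>The coefficient ring \<^typ>\<open>rat fps\<close> is not a field, but \<open>(1 - y)\<^sup>2\<close> is a unit:\<close>

lemma one_div_var_y: "1 / (1 - var_y) ^ 2 * (1 - var_y) ^ 2 = 1"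
proof -
  define f where "f = (1 - var_y) ^ 2"
  have 0: "fps_nth f 0 = 1"
    by (simp add: f_def fps_nth_power_0 power2_eq_square)
  have "1 / f = fps_right_inverse f 1"
    using 0 by (simp add: fps_divide_unit fps_inverse_def[of f])
  moreover have "f * fps_right_inverse f 1 = 1"
    using 0 by (intro fps_right_inverse) simp
  ultimately show ?thesis by (simp add: f_def mult.commute)
qed

text \<open>
  \<open>subst_y f g\<close> is \<open>f(x, g(x))\<close>; the series converges in the \<open>x\<close>-adic metric whenever \<open>g\<close> has no
  constant term. (\<^const>\<open>fps_compose\<close> is not applicable: as an element of
  \<^typ>\<open>rat fps fps\<close>, a series in \<open>x\<close> alone is a constant.)
\<close>

definition subst_y :: "rat fps fps \<Rightarrow> rat fps \<Rightarrow> rat fps" where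
  "subst_y f g = (\<Sum>j. fps_nth f j * g ^ j)"

lemma subst_y_sums:
  assumes "fps_nth g 0 = 0"
  shows "(\<lambda>j. fps_nth f j * g ^ j) sums subst_y f g"
proof -
  define s where "s = Abs_fps (\<lambda>n. \<Sum>j\<le>n. fps_nth (fps_nth f j * g ^ j) n)"
  have zero: "fps_nth (fps_nth f j * g ^ j) n = 0" if "n < j" for j n
    using that assms by (auto simp: fps_mult_nth startsby_zero_power_prefix intro!: sum.neutral)
  have "(\<lambda>j. fps_nth f j * g ^ j) sums s"
    unfolding sums_def
  proof (rule tendsto_fpsI)
    fix n
    have "fps_nth (\<Sum>j<N. fps_nth f j * g ^ j) n = fps_nth s n" if "N \<ge> Suc n" for N
    proof -
      have "(\<Sum>j<N. fps_nth (fps_nth f j * g ^ j) n) = (\<Sum>j\<le>n. fps_nth (fps_nth f j * g ^ j) n)"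
        using that by (intro sum.mono_neutral_right) (auto simp: zero)
      thus ?thesis by (simp add: s_def fps_sum_nth)
    qed
    thus "eventually (\<lambda>N. fps_nth (\<Sum>j<N. fps_nth f j * g ^ j) n = fps_nth s n) sequentially"
      using eventually_sequentially by blast
  qed
  thus ?thesis unfolding subst_y_def using sums_unique by blast
qed

end

theory Submission
  imports Defs
begin

text \<open>
  Multiplying \<open>F\<^sub>r\<close> by \<open>1 - y\<close> fixes \<open>d\<^sub>0 = -j\<close>; write \<open>H\<^sub>j\<close> for the coefficient of \<open>y\<^sup>j\<close> in the
  result, a power series in \<open>x\<close>, and \<open>A\<^sub>j\<close> for the coefficient of \<open>y\<^sup>j\<close> in \<open>F\<^bsub>r-1\<^esub>\<close>. Splitting
  according to whether \<open>c\<^sub>1 = 0\<close> or \<open>c\<^sub>1 \<ge> 1\<close>, and lowering all \<open>c\<^sub>i\<close> and \<open>d\<^sub>i\<close> by one in the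
  second case, gives \<open>H\<^sub>j = A\<^sub>j + x\<^sup>r H\<^bsub>j+1\<^esub>\<close>. Thus multiplication of \<open>\<Sum> H\<^sub>j y\<^sup>j\<close> by \<open>x\<^sup>r - y\<close>
  telescopes to \<open>x\<^sup>r H\<^sub>0 - \<Sum> A\<^sub>j y\<^bsup>j+1\<^esup>\<close>, and iterating the recursion gives
  \<open>H\<^sub>0 = \<Sum> A\<^sub>j x\<^bsup>rj\<^esup> = F\<^bsub>r-1\<^esub>(x, x\<^sup>r)\<close>.
\<close>

lemma nested_shift: "nested (d + a) (map (\<lambda>c. c + a) cs) = nested d cs"
proof (induction cs arbitrary: d)
  case (Cons c cs)
  have "(\<Sum>e=d+a..c+a. nested e (map (\<lambda>c. c + a) cs))
      = (\<Sum>e=d..c. nested (e + a) (map (\<lambda>c. c + a) cs))"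
    by (rule sum.reindex_bij_witness[of _ "\<lambda>e. e + a" "\<lambda>e. e - a"]) auto
  then show ?case by (simp add: Cons.IH)
qed simp

text \<open>The part of \<open>alpha\<close> with d_0 = -j, that is, the coefficient of x^k in
  H_j.\<close>

definition slice :: "nat \<Rightarrow> nat \<Rightarrow> nat \<Rightarrow> nat" where
  "slice r k j = (\<Sum>cs\<in>parts r k. nested (- int j) cs)"

lemma alpha_0_right: "alpha r k 0 = slice r k 0"
  by (simp add: alpha_def slice_def)

lemma alpha_Suc_right: "alpha r k (Suc j) = alpha r k j + slice r k (Suc j)"
proof -
  have "{- int (Suc j)..0} = insert (- int (Suc j)) {- int j..0}" by auto
  then show ?thesis by (simp add: alpha_def slice_def sum.distrib)
qed

text \<open>The first entry of a sorted list is its minimum: either it is 0 and is dropped, or all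
  \<open>Suc r\<close> entries are positive and lowering each by one takes \<open>Suc r\<close> off
  the sum. The guard keeps the subtraction of naturals exact.\<close>

lemma parts_Suc_eq:
  "parts (Suc r) k = (#) 0 ` parts r k \<union>
     (if Suc r \<le> k then map (\<lambda>c. c + 1) ` parts (Suc r) (k - Suc r) else {})"
  (is "_ = ?A \<union> ?B")
proof (intro equalityI subsetI)
  fix cs assume "cs \<in> parts (Suc r) k"
  then obtain c cs' where cs: "cs = c # cs'" "length cs' = r" "sorted (c # cs')" "0 \<le> c"
      "\<forall>b\<in>set cs'. 0 \<le> b" "c + sum_list cs' = int k"
    by (cases cs) (auto simp: parts_def)
  show "cs \<in> ?A \<union> ?B"
  proof (cases "c = 0")
    case True
    then show ?thesis using cs by (auto simp: parts_def)
  next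
    case False
    with cs have pos: "\<forall>b\<in>set cs. 1 \<le> b" by force
    let ?ds = "map (\<lambda>c. c - 1) cs"
    have "sum_list ?ds = sum_list cs - int (length cs)"
      by (induction cs) auto
    then have sum: "sum_list ?ds = int k - int (Suc r)" using cs by simp
    have nonneg: "\<forall>b\<in>set ?ds. 0 \<le> b" using pos by auto
    then have "0 \<le> sum_list ?ds" by (intro sum_list_nonneg) blast
    then have le: "Suc r \<le> k" unfolding sum by simp
    have "sorted cs" using cs(1,3) by simp
    then have "sorted ?ds"
      unfolding sorted_map by (rule sorted_wrt_mono_rel[rotated]) simp
    then have "?ds \<in> parts (Suc r) (k - Suc r)"
      using nonneg sum le cs(1,2) unfolding parts_def by (simp add: of_nat_diff)
    moreover have "cs = map (\<lambda>c. c + 1) ?ds" by (simp add: comp_def)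
    ultimately have "cs \<in> map (\<lambda>c. c + 1) ` parts (Suc r) (k - Suc r)"
      by (rule rev_image_eqI)
    then show ?thesis using le by simp
  qed
next
  fix cs assume "cs \<in> ?A \<union> ?B"
  then show "cs \<in> parts (Suc r) k"
  proof
    assume "cs \<in> ?A"
    then show ?thesis by (auto simp: parts_def)
  next
    assume "cs \<in> ?B"
    then obtain ds where le: "Suc r \<le> k" and ds: "ds \<in> parts (Suc r) (k - Suc r)"
        "cs = map (\<lambda>c. c + 1) ds"
      by (auto split: if_splits)
    have "sum_list cs = sum_list ds + int (length ds)"
      unfolding ds(2) by (induction ds) auto
    then show ?thesis using ds le by (auto simp: parts_def sorted_map of_nat_diff)
  qed
qed

text \<open>If c_1 = 0, then d_1 runs from -j to 0, just as d_0 does in \<open>alpha r k j\<close>.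
  Otherwise lowering by one moves the start from -j to -(j+1).\<close>

lemma slice_Suc_left:
  "slice (Suc r) k j =
     alpha r k j + (if Suc r \<le> k then slice (Suc r) (k - Suc r) (Suc j) else 0)"
proof -
  let ?B = "if Suc r \<le> k then map (\<lambda>c. c + 1) ` parts (Suc r) (k - Suc r) else {}"
  have disj: "(#) 0 ` parts r k \<inter> ?B = {}"
    by (auto simp: parts_def)
  have "(\<Sum>cs\<in>(#) 0 ` parts r k. nested (- int j) cs) = alpha r k j"
    by (simp add: sum.reindex alpha_def)
  moreover have "(\<Sum>cs\<in>map (\<lambda>c. c + 1) ` parts (Suc r) m. nested (- int j) cs)
      = slice (Suc r) m (Suc j)" for m
  proof -
    have "inj (map (\<lambda>c::int. c + 1))" by (simp add: inj_mapI inj_def)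
    then show ?thesis
      using nested_shift[of "- int (Suc j)" 1]
      by (simp add: sum.reindex inj_on_subset[OF _ subset_UNIV] slice_def)
  qed
  ultimately show ?thesis
    unfolding slice_def[of "Suc r" k] parts_Suc_eq[of r k]
    using disj finite_parts by (subst sum.union_disjoint) auto
qed

definition slice_fps :: "nat \<Rightarrow> nat \<Rightarrow> rat fps" where
  "slice_fps r j = Abs_fps (\<lambda>k. of_nat (slice r k j))"

lemma slice_fps_Suc_left:
  "slice_fps (Suc r) j = fps_nth (genfun r) j + fps_X ^ Suc r * slice_fps (Suc r) (Suc j)"
  by (rule fps_ext)
    (simp only: slice_fps_def genfun_def fps_nth_Abs_fps fps_add_nth fps_X_power_mult_nth,
      simp add: slice_Suc_left[of r _ j])

text \<open>\<open>alpha r k j\<close> is the sum of \<open>slice r k i\<close> over i \<le> j, and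
  multiplication by 1 - y takes differences in j.\<close>

lemma genfun_times_one_minus_y: "genfun r * (1 - var_y) = Abs_fps (slice_fps r)"
proof (rule fps_ext)
  fix j
  show "fps_nth (genfun r * (1 - var_y)) j = fps_nth (Abs_fps (slice_fps r)) j"
  proof (cases j)
    case 0
    then show ?thesis by (simp add: genfun_def slice_fps_def alpha_0_right)
  next
    case (Suc i)
    then show ?thesis
      by (simp add: right_diff_distrib genfun_def slice_fps_def fps_eq_iff alpha_Suc_right)
  qed
qed

lemma slice_fps_0_eq_subst_y:
  "slice_fps (Suc r) 0 = subst_y (genfun r) (fps_X ^ Suc r)"
proof -
  let ?g = "fps_X ^ Suc r :: rat fps"
  let ?S = "\<lambda>n. \<Sum>j<n. fps_nth (genfun r) j * ?g ^ j"
  \<comment> \<open>Unrolling the recursion \<open>n\<close> times leaves a remainder divisible by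
    x^((r+1)n).\<close>
  have iter: "slice_fps (Suc r) 0 = ?S n + ?g ^ n * slice_fps (Suc r) n" for n
  proof (induction n)
    case (Suc n)
    then show ?case by (simp add: slice_fps_Suc_left[of r n] algebra_simps)
  qed simp
  have "?S \<longlonglongrightarrow> slice_fps (Suc r) 0"
  proof (rule tendsto_fpsI)
    fix k
    have "fps_nth (?S n) k = fps_nth (slice_fps (Suc r) 0) k" if "n \<ge> Suc k" for n
    proof -
      \<comment> \<open>Hence the remainder does not reach the coefficient of x^k once n >
        k.\<close>
      have "k < Suc r * n" using that by simp
      then have "fps_nth (?g ^ n * slice_fps (Suc r) n) k = 0"
        by (simp only: power_mult[symmetric] fps_X_power_mult_nth if_True)
      then show ?thesis by (subst iter[of n]) (simp only: fps_add_nth)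
    qed
    then show "\<forall>\<^sub>F n in sequentially. fps_nth (?S n) k = fps_nth (slice_fps (Suc r) 0) k"
      using eventually_sequentially by blast
  qed
  moreover have "?S \<longlonglongrightarrow> subst_y (genfun r) ?g"
    using subst_y_sums[of ?g "genfun r"] by (simp add: sums_def)
  ultimately show ?thesis by (rule LIMSEQ_unique)
qed

lemma genfun_Suc:
  "genfun (Suc r) * ((var_x ^ Suc r - var_y) * (1 - var_y)) =
     fps_const (subst_y (genfun r) (fps_X ^ Suc r)) * var_x ^ Suc r - genfun r * var_y"
proof -
  let ?g = "fps_X ^ Suc r :: rat fps"
  have "genfun (Suc r) * ((var_x ^ Suc r - var_y) * (1 - var_y))
      = Abs_fps (slice_fps (Suc r)) * (fps_const ?g - var_y)"
    by (simp only: genfun_times_one_minus_y[symmetric] fps_const_power mult_ac)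
  also have "\<dots> = fps_const (slice_fps (Suc r) 0) * fps_const ?g - genfun r * var_y"
  proof (rule fps_ext)
    fix j
    show "fps_nth (Abs_fps (slice_fps (Suc r)) * (fps_const ?g - var_y)) j
        = fps_nth (fps_const (slice_fps (Suc r) 0) * fps_const ?g - genfun r * var_y) j"
    proof (cases j)
      case 0
      then show ?thesis by (simp add: right_diff_distrib)
    next
      \<comment> \<open>The recursion gives x^(r+1) H_(i+1) - H_i = -A_i, so only the coefficient at
        j = 0 keeps a term in H.\<close>
      case (Suc i)
      then show ?thesis
        by (simp add: right_diff_distrib slice_fps_Suc_left[of r i] mult_ac)
    qed
  qed
  finally show ?thesis
    by (simp only: slice_fps_0_eq_subst_y fps_const_power)
qed

lemma genfun_0: "genfun 0 = 1 / (1 - var_y) ^ 2"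
proof -
  have "parts 0 k = (if k = 0 then {[]} else {})" for k
    by (auto simp: parts_def)
  \<comment> \<open>Only the empty list, at \<open>k = 0\<close>, contributes, so every H_j is 1 and
    their series in y is geometric.\<close>
  then have "slice_fps 0 j = 1" for j
    by (auto simp: slice_fps_def slice_def fps_eq_iff)
  then have "Abs_fps (slice_fps 0) * (1 - var_y) = 1"
    by (intro fps_ext) (simp add: right_diff_distrib)
  then have "genfun 0 * (1 - var_y) * (1 - var_y) = 1"
    by (simp only: genfun_times_one_minus_y)
  then have "genfun 0 * (1 - var_y) ^ 2 = 1 / (1 - var_y) ^ 2 * (1 - var_y) ^ 2"
    unfolding one_div_var_y by (simp add: power2_eq_square mult.assoc)
  moreover have "(1 - var_y) ^ 2 \<noteq> 0"
    using one_div_var_y by force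
  ultimately show ?thesis by simp
qed

theorem proposition3:
  shows "genfun 0 = 1 / (1 - var_y) ^ 2 \<and>
    (\<forall>r\<ge>1. genfun r * ((var_x ^ r - var_y) * (1 - var_y)) =
       fps_const (subst_y (genfun (r - 1)) (fps_X ^ r)) * var_x ^ r - genfun (r - 1) * var_y)"
proof (intro conjI allI impI)
  fix r :: nat assume "r \<ge> 1"
  then obtain s where "r = Suc s" by (cases r) auto
  then show "genfun r * ((var_x ^ r - var_y) * (1 - var_y)) =
      fps_const (subst_y (genfun (r - 1)) (fps_X ^ r)) * var_x ^ r - genfun (r - 1) * var_y"
    using genfun_Suc[of s] by simp
qed (rule genfun_0)

end
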